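(* Let $A\in\mathbb{R}^{n\times n}$ be invertible. The multi-delay stochastic system $$x_{t+1}=Ax_t+\sum_{\tau=0}^D (B_\tau+\omega_t^\tau C_\tau)u_{t-\tau},\qquad t\ge 0,$$ is asymptotically mean-square stabilizable if and only if there exist constant matrices $L_0\in\mathbb{R}^{m\times n}$ and $L_1,\dots,L_D\in\mathbb{R}^{m\times m}$ such that the feedback control law $$u_t=L_0\hat\eta_{t|t-1}+\sum_{\tau=1}^D L_\tau u_{t-\tau}$$ belongs to the admissible set $\mathcal{U}_{ad}$ and the closed-loop auxiliary system $$\eta_{t+1}=A\eta_t+\sum_{j=0}^D A^{-j}(B_j+\omega_{t+j}^jC_j)u_t$$ obtained with this control law is asymptotically mean-square stable, i.e. $\lim_{t\to\infty}\mathbf{E}(\eta_t'\eta_t)=0$ for all initial data $x_0$, $u_{-D},\dots,u_{-1}$.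
   Context: Primes denote transposes and $\mathbf{E}$ denotes expectation. $D\ge 0$ is an integer (empty sums are zero), $x_t\in\mathbb{R}^n$ is the state, $u_t\in\mathbb{R}^m$ is the control input, and $A\in\mathbb{R}^{n\times n}$, $B_\tau,C_\tau\in\mathbb{R}^{n\times m}$ ($\tau=0,\dots,D$) are constant. The initial data $x_0$ and $u_t$, $t=-D,\dots,-1$, are given a priori (deterministic). Noise: $\{\omega_t^\tau\}_{t\ge0}$, $\tau=0,\dots,D$, are real random sequences, independent and identically distributed in time for each $\tau$ and mutually independent for different $\tau$, with $\mathbf{E}(\omega_t^\tau)=0$ and $\mathbf{E}(\omega_t^\tau\omega_s^\tau)=\sigma_\tau^2\delta_{ts}$ ($\delta_{ts}$ the Kronecker delta). Put $\omega_t=(\omega_t^0,\dots,\omega_t^D)'$ and $\mathcal{F}_t=\sigma\{\omega_s: 0\le s\le t\}$, with $\mathcal{F}_{-1}$ trivial. Admissible controls: $\mathcal{U}_{ad}$ is the set of control processes $u$ such that $u_t$ is $\mathcal{F}_t$-measurable, $\sum_{t=0}^\infty\mathbf{E}(u_t'u_t)<\infty$, and $u_t=K_0x_t+\sum_{\tau=1}^DK_\tau u_{t-\tau}$ for all $t\ge 0$, for some constant matrices $K_0,\dots,K_D$ of compatible dimensions. (Such $u_t$ is then in fact $\mathcal{F}_{t-1}$-measurable.) Stabilizability: the system for $x_t$ is asymptotically mean-square stabilizable if there exists a feedback control law (constant gains $K_0,\dots,K_D$) in $\mathcal{U}_{ad}$ such that the closed-loop system satisfies $\lim_{t\to\infty}\mathbf{E}(x_t'x_t)=0$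 for any initial values $x_0$ and $u_t$, $t=-D,\dots,-1$. Auxiliary state: $$\eta_t=x_t+\sum_{\tau=1}^D\Big[\sum_{j=\tau}^DA^{\tau-j-1}\big(B_j+\omega^j_{t+j-\tau}C_j\big)\Big]u_{t-\tau},$$ which satisfies the auxiliary recursion in the claim, and $\hat\eta_{t|t-1}=\mathbf{E}[\eta_t\mid\mathcal{F}_{t-1}]$. *)

theory Defs
  imports "HOL-Probability.Probability"
begin

text \<open>
  On \<open>real ^ 'n ^ 'n\<close> the operator \<open>^\<close> is the componentwise power, so integer powers of a matrix
  with respect to \<open>**\<close> are defined here. Negative powers are meaningful for invertible matrices.
\<close>

definition mat_powi :: "real ^ 'n ^ 'n \<Rightarrow> int \<Rightarrow> real ^ 'n ^ 'n" where
  "mat_powi A k = (if k \<ge> 0 then (((**) A) ^^ nat k) (mat 1)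
                   else (((**) (matrix_inv A)) ^^ nat (- k)) (mat 1))"

text \<open>
  \<open>\<omega> \<tau> t\<close> is the noise of channel \<open>\<tau>\<close> at time \<open>t\<close>; only the channels \<open>\<tau> \<le> D\<close> matter.
  The last assumption says that the whole sequences \<open>\<omega> 0, \<dots>, \<omega> D\<close>, as random elements of the
  product space of real sequences, are independent of each other.
  A control process \<open>u\<close> is indexed by all integers, but only its values at times \<open>\<ge> - D\<close> are used.
\<close>

locale delay_system = prob_space M for M :: "'a measure" +
  fixes D :: nat
    and \<sigma> :: "nat \<Rightarrow> real"
    and \<omega> :: "nat \<Rightarrow> nat \<Rightarrow> 'a \<Rightarrow> real"
    and A :: "real ^ 'n ^ 'n"
    and B C :: "nat \<Rightarrow> real ^ 'm ^ 'n"
  assumes independent_in_time: "\<And>\<tau>. \<tau> \<le> D \<Longrightarrow> indep_vars (\<lambda>_. borel) (\<omega> \<tau>) UNIV"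
    and identically_distributed:
      "\<And>\<tau> t. \<tau> \<le> D \<Longrightarrow> distr M borel (\<omega> \<tau> t) = distr M borel (\<omega> \<tau> 0)"
    and integrable_noise: "\<And>\<tau> t. \<tau> \<le> D \<Longrightarrow> integrable M (\<omega> \<tau> t)"
    and noise_mean: "\<And>\<tau> t. \<tau> \<le> D \<Longrightarrow> expectation (\<omega> \<tau> t) = 0"
    and integrable_noise_mult:
      "\<And>\<tau> t s. \<tau> \<le> D \<Longrightarrow> integrable M (\<lambda>z. \<omega> \<tau> t z * \<omega> \<tau> s z)"
    and noise_covariance:
      "\<And>\<tau> t s. \<tau> \<le> D \<Longrightarrow>
         expectation (\<lambda>z. \<omega> \<tau> t z * \<omega> \<tau> s z) = (\<sigma> \<tau>)\<^sup>2 * (if t = s then 1 else 0)"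
    and independent_channels:
      "indep_vars (\<lambda>_. \<Pi>\<^sub>M t\<in>UNIV. borel) (\<lambda>\<tau> z. \<lambda>t\<in>UNIV. \<omega> \<tau> t z) {..D}"
begin

text \<open>The time index is an integer so that \<open>filt (- 1)\<close> is the trivial sigma-algebra.\<close>

definition filt :: "int \<Rightarrow> 'a measure" where
  "filt t = sigma (space M)
     {\<omega> \<tau> s -` S \<inter> space M | \<tau> s S. \<tau> \<le> D \<and> int s \<le> t \<and> S \<in> sets (borel :: real measure)}"

text \<open>
  The expectation of the squared Euclidean norm, taken in \<open>[0, \<infinity>]\<close>, so that non-integrability
  shows up as the value \<open>\<infinity>\<close> and not as the default value of the Bochner integral.
\<close>

definition second_moment :: "('a \<Rightarrow> real ^ 'k) \<Rightarrow> ennreal" where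
  "second_moment X = (\<integral>\<^sup>+ z. ennreal (X z \<bullet> X z) \<partial>M)"

primrec state :: "real ^ 'n \<Rightarrow> (int \<Rightarrow> 'a \<Rightarrow> real ^ 'm) \<Rightarrow> nat \<Rightarrow> 'a \<Rightarrow> real ^ 'n" where
  "state x0 u 0 = (\<lambda>z. x0)"
| "state x0 u (Suc t) = (\<lambda>z. A *v state x0 u t z
     + (\<Sum>\<tau>=0..D. (B \<tau> + \<omega> \<tau> t z *\<^sub>R C \<tau>) *v u (int t - int \<tau>) z))"

text \<open>
  Here \<open>j \<ge> \<tau>\<close>, so the natural number subtraction in the noise index does not truncate.
\<close>

definition aux_state :: "real ^ 'n \<Rightarrow> (int \<Rightarrow> 'a \<Rightarrow> real ^ 'm) \<Rightarrow> nat \<Rightarrow> 'a \<Rightarrow> real ^ 'n" where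
  "aux_state x0 u t = (\<lambda>z. state x0 u t z
     + (\<Sum>\<tau>=1..D. (\<Sum>j=\<tau>..D. mat_powi A (int \<tau> - int j - 1)
                              ** (B j + \<omega> j (t + j - \<tau>) z *\<^sub>R C j)) *v u (int t - int \<tau>) z))"

text \<open>
  The auxiliary recursion; started at \<open>aux_state x0 u 0\<close> it reproduces \<open>aux_state x0 u\<close> for
  invertible \<open>A\<close>, see \<open>aux_system_eq_aux_state\<close> below.
\<close>

primrec aux_system :: "('a \<Rightarrow> real ^ 'n) \<Rightarrow> (int \<Rightarrow> 'a \<Rightarrow> real ^ 'm) \<Rightarrow> nat \<Rightarrow> 'a \<Rightarrow> real ^ 'n" where
  "aux_system \<eta>0 u 0 = \<eta>0"
| "aux_system \<eta>0 u (Suc t) = (\<lambda>z. A *v aux_system \<eta>0 u t z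
     + (\<Sum>j=0..D. mat_powi A (- int j) ** (B j + \<omega> j (t + j) z *\<^sub>R C j)) *v u (int t) z)"

text \<open>
  The conditional expectation of the auxiliary state at time \<open>t\<close> given the noise up to time
  \<open>t - 1\<close>, componentwise.
\<close>

definition aux_predictor :: "real ^ 'n \<Rightarrow> (int \<Rightarrow> 'a \<Rightarrow> real ^ 'm) \<Rightarrow> nat \<Rightarrow> 'a \<Rightarrow> real ^ 'n" where
  "aux_predictor x0 u t =
     (\<lambda>z. \<chi> i. real_cond_exp M (filt (int t - 1)) (\<lambda>z'. aux_state x0 u t z' $ i) z)"

definition state_feedback ::
  "real ^ 'n ^ 'm \<Rightarrow> (nat \<Rightarrow> real ^ 'm ^ 'm) \<Rightarrow> real ^ 'n \<Rightarrow> (int \<Rightarrow> 'a \<Rightarrow> real ^ 'm) \<Rightarrow> nat \<Rightarrow> 'a \<Rightarrow> real ^ 'm"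
where
  "state_feedback K0 K x0 u t =
     (\<lambda>z. K0 *v state x0 u t z + (\<Sum>\<tau>=1..D. K \<tau> *v u (int t - int \<tau>) z))"

definition predictor_feedback ::
  "real ^ 'n ^ 'm \<Rightarrow> (nat \<Rightarrow> real ^ 'm ^ 'm) \<Rightarrow> real ^ 'n \<Rightarrow> (int \<Rightarrow> 'a \<Rightarrow> real ^ 'm) \<Rightarrow> nat \<Rightarrow> 'a \<Rightarrow> real ^ 'm"
where
  "predictor_feedback L0 L x0 u t =
     (\<lambda>z. L0 *v aux_predictor x0 u t z + (\<Sum>\<tau>=1..D. L \<tau> *v u (int t - int \<tau>) z))"

text \<open>
  \<open>u\<close> has the deterministic initial values \<open>\<phi>\<close> and is generated by the feedback law \<open>G\<close>. For the
  two laws above such a \<open>u\<close> exists and is unique at times \<open>\<ge> - D\<close>; see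
  \<open>closed_loop_exists\<close> and \<open>closed_loop_unique\<close> below.
\<close>

definition closed_loop ::
  "((int \<Rightarrow> 'a \<Rightarrow> real ^ 'm) \<Rightarrow> nat \<Rightarrow> 'a \<Rightarrow> real ^ 'm) \<Rightarrow> (int \<Rightarrow> real ^ 'm) \<Rightarrow> (int \<Rightarrow> 'a \<Rightarrow> real ^ 'm) \<Rightarrow> bool"
where
  "closed_loop G \<phi> u \<longleftrightarrow>
     (\<forall>t\<in>{- int D..<0}. u t = (\<lambda>z. \<phi> t)) \<and> (\<forall>t::nat. u (int t) = G u t)"

text \<open>
  The set depends on the initial state because the linear feedback form refers to the state
  that \<open>u\<close> generates from it. Since conditional expectations are only determined up to null sets,
  the feedback form is required almost surely.
\<close>

definition U_ad :: "real ^ 'n \<Rightarrow> (int \<Rightarrow> 'a \<Rightarrow> real ^ 'm) set" where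
  "U_ad x0 = {u. (\<forall>t::nat. u (int t) \<in> borel_measurable (filt (int t)))
     \<and> (\<Sum>t::nat. second_moment (u (int t))) < \<infinity>
     \<and> (\<exists>K0 K. \<forall>t::nat. AE z in M. u (int t) z = state_feedback K0 K x0 u t z)}"

definition ms_stabilizable :: bool where
  "ms_stabilizable \<longleftrightarrow>
     (\<exists>K0 K. \<forall>x0 \<phi> u. closed_loop (state_feedback K0 K x0) \<phi> u \<longrightarrow>
        u \<in> U_ad x0 \<and> (\<lambda>t. second_moment (state x0 u t)) \<longlonglongrightarrow> 0)"

end

lemma mat_powi_neg_Suc:
  fixes A :: "real ^ 'n ^ 'n"
  assumes "invertible A"
  shows "A ** mat_powi A (- int (Suc k)) = mat_powi A (- int k)"
proof -
  have *: "A ** matrix_inv A = mat 1"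
    unfolding matrix_inv_def using assms someI_ex[of "\<lambda>A'. A ** A' = mat 1 \<and> A' ** A = mat 1"]
    by (simp add: invertible_def)
  then have "A ** (matrix_inv A ** X) = X" for X :: "real ^ 'n ^ 'n"
    by (simp add: matrix_mul_assoc)
  with * show ?thesis
    by (cases k) (auto simp: mat_powi_def nat_add_distrib)
qed

context delay_system
begin

lemma aux_state_Suc:
  assumes "invertible A"
  shows "aux_state x0 u (Suc t) z = A *v aux_state x0 u t z
     + (\<Sum>j=0..D. mat_powi A (- int j) ** (B j + \<omega> j (t + j) z *\<^sub>R C j)) *v u (int t) z"
proof -
  define N where "N j s = B j + \<omega> j s z *\<^sub>R C j" for j s
  define P where "P k = mat_powi A (- int k)" for k
  define v where "v \<tau> = u (int t - int \<tau>) z" for \<tau> :: nat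
  define f where "f \<tau> = (\<Sum>j=\<tau>..D. P (j + 1 - \<tau>) ** N j (Suc t + j - \<tau>)) *v u (int (Suc t) - int \<tau>) z" for \<tau>
  define g where "g \<tau> = (\<Sum>j=Suc \<tau>..D. P (j - \<tau>) ** N j (t + j - \<tau>)) *v v \<tau>" for \<tau>
  define h where "h \<tau> = (\<Sum>j=\<tau>..D. P (j + 1 - \<tau>) ** N j (t + j - \<tau>)) *v v \<tau>" for \<tau>
  define k where "k \<tau> = (\<Sum>j=\<tau>..D. P (j - \<tau>) ** N j (t + j - \<tau>)) *v v \<tau>" for \<tau>
  have A_sum: "A ** (\<Sum>j\<in>J. X j) = (\<Sum>j\<in>J. A ** X j)" if "finite J" for J :: "nat set" and X :: "nat \<Rightarrow> real ^ 'm ^ 'n"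
    using that by (induction J) (auto simp: matrix_add_ldistrib)
  have Av_sum: "A *v (\<Sum>j\<in>J. X j) = (\<Sum>j\<in>J. A *v X j)" if "finite J" for J :: "nat set" and X :: "nat \<Rightarrow> real ^ 'n"
    using that by (induction J) (auto simp: matrix_vector_right_distrib)
  have P: "mat_powi A (int \<tau> - int j - 1) = P (j + 1 - \<tau>)" if "\<tau> \<le> j" for \<tau> j
  proof -
    have "int \<tau> - int j - 1 = - int (j + 1 - \<tau>)" using that by simp
    then show ?thesis by (simp only: P_def)
  qed
  have AP: "A ** P (j + 1 - \<tau>) = P (j - \<tau>)" if "\<tau> \<le> j" for \<tau> j
    using mat_powi_neg_Suc[OF assms, of "j - \<tau>"] that by (simp only: P_def Suc_diff_le Suc_eq_plus1[symmetric])
  have fg: "f (Suc \<tau>) = g \<tau>" for \<tau>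
    by (simp add: f_def g_def v_def)
  have kg: "k \<tau> = N \<tau> t *v v \<tau> + g \<tau>" if "\<tau> \<le> D" for \<tau>
    using that by (simp add: k_def g_def P_def mat_powi_def sum.atLeast_Suc_atMost matrix_vector_mult_add_rdistrib)
  have Ah: "A *v h \<tau> = k \<tau>" for \<tau>
  proof -
    have "A ** (\<Sum>j=\<tau>..D. P (j + 1 - \<tau>) ** N j (t + j - \<tau>))
        = (\<Sum>j=\<tau>..D. P (j - \<tau>) ** N j (t + j - \<tau>))"
      unfolding A_sum[OF finite_atLeastAtMost]
      by (rule sum.cong) (simp_all only: matrix_mul_assoc AP atLeastAtMost_iff)
    then show ?thesis
      by (simp only: h_def k_def matrix_vector_mul_assoc)
  qed
  have "aux_state x0 u (Suc t) z
      = A *v state x0 u t z + (\<Sum>\<tau>=0..D. N \<tau> t *v v \<tau>) + (\<Sum>\<tau>=1..D. f \<tau>)"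
    unfolding aux_state_def f_def
    by (auto simp: N_def v_def P intro!: sum.cong arg_cong2[where f = "(*v)"])
  also have "(\<Sum>\<tau>=1..D. f \<tau>) = (\<Sum>\<tau>=0..<D. g \<tau>)"
    using sum.shift_bounds_Suc_ivl[of f 0 D] by (simp add: fg atLeastLessThanSuc_atLeastAtMost)
  also have "\<dots> = (\<Sum>\<tau>=0..D. g \<tau>)"
    by (simp add: atLeastLessThanSuc_atLeastAtMost[symmetric] g_def)
  also have "A *v state x0 u t z + (\<Sum>\<tau>=0..D. N \<tau> t *v v \<tau>) + (\<Sum>\<tau>=0..D. g \<tau>)
      = A *v state x0 u t z + (\<Sum>\<tau>=0..D. k \<tau>)"
    by (simp add: kg sum.distrib)
  also have "(\<Sum>\<tau>=0..D. k \<tau>) = k 0 + (\<Sum>\<tau>=1..D. k \<tau>)"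
    by (simp add: sum.atLeast_Suc_atMost)
  also have "(\<Sum>\<tau>=1..D. k \<tau>) = A *v (\<Sum>\<tau>=1..D. h \<tau>)"
    by (simp add: Av_sum Ah)
  also have "A *v state x0 u t z + (k 0 + A *v (\<Sum>\<tau>=1..D. h \<tau>))
      = A *v (state x0 u t z + (\<Sum>\<tau>=1..D. h \<tau>)) + k 0"
    by (simp add: matrix_vector_right_distrib)
  also have "state x0 u t z + (\<Sum>\<tau>=1..D. h \<tau>) = aux_state x0 u t z"
    unfolding aux_state_def h_def
    by (auto simp: N_def v_def P intro!: sum.cong arg_cong2[where f = "(*v)"])
  also have "k 0 = (\<Sum>j=0..D. mat_powi A (- int j) ** (B j + \<omega> j (t + j) z *\<^sub>R C j)) *v u (int t) z"
    by (simp add: k_def P_def N_def v_def)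
  finally show ?thesis .
qed

lemma aux_system_eq_aux_state:
  assumes "invertible A"
  shows "aux_system (aux_state x0 u 0) u t = aux_state x0 u t"
  by (induction t) (auto simp: aux_state_Suc[OF assms] fun_eq_iff)

lemma state_causal:
  assumes "\<And>s. - int D \<le> s \<Longrightarrow> s < int t \<Longrightarrow> u s = v s"
  shows "state x0 u t = state x0 v t"
  using assms by (induction t) (auto simp: fun_eq_iff intro!: sum.cong)

lemma state_feedback_causal:
  assumes "\<And>s. - int D \<le> s \<Longrightarrow> s < int t \<Longrightarrow> u s = v s"
  shows "state_feedback K0 K x0 u t = state_feedback K0 K x0 v t"
  using state_causal[of t u v] assms
  by (auto simp: state_feedback_def fun_eq_iff intro!: sum.cong)

lemma predictor_feedback_causal:
  assumes "\<And>s. - int D \<le> s \<Longrightarrow> s < int t \<Longrightarrow> u s = v s"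
  shows "predictor_feedback L0 L x0 u t = predictor_feedback L0 L x0 v t"
proof -
  have "aux_state x0 u t = aux_state x0 v t"
    using state_causal[of t u v] assms
    by (auto simp: aux_state_def fun_eq_iff intro!: sum.cong)
  then show ?thesis
    using assms by (auto simp: predictor_feedback_def aux_predictor_def fun_eq_iff intro!: sum.cong)
qed

lemma closed_loop_exists:
  assumes causal: "\<And>u v t. (\<And>s. - int D \<le> s \<Longrightarrow> s < int t \<Longrightarrow> u s = v s) \<Longrightarrow> G u t = G v t"
  shows "\<exists>u. closed_loop G \<phi> u"
proof -
  define H where "H = rec_nat (\<lambda>s z. \<phi> s) (\<lambda>t u. u(int t := G u t))"
  have H0: "H 0 = (\<lambda>s z. \<phi> s)" and HS: "H (Suc t) = (H t)(int t := G (H t) t)" for t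
    by (simp_all add: H_def)
  have stable: "H (t + k) s = H t s" if "s < int t" for t k s
    using that by (induction k) (auto simp: HS)
  have neg: "H t s = (\<lambda>z. \<phi> s)" if "s < 0" for t s
    using that by (induction t) (auto simp: H0 HS)
  define u where "u s = H (nat (s + 1)) s" for s
  have u_eq: "u s = H t s" if "s < int t" for s t
  proof (cases "s < 0")
    case True
    then show ?thesis by (simp add: u_def neg)
  next
    case False
    then have "t = nat (s + 1) + (t - nat (s + 1))" using that by linarith
    then show ?thesis using stable[of s "nat (s + 1)" "t - nat (s + 1)"] False
      by (simp add: u_def)
  qed
  have law: "u (int t) = G u t" for t
  proof -
    have "u (int t) = G (H t) t"
      using u_eq[of "int t" "Suc t"] by (simp add: HS)
    also have "\<dots> = G u t"
      by (rule causal) (simp add: u_eq)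
    finally show ?thesis .
  qed
  have "u t = (\<lambda>z. \<phi> t)" if "t < 0" for t
    using that by (simp add: u_def neg)
  with law have "closed_loop G \<phi> u"
    by (simp add: closed_loop_def)
  then show ?thesis by (rule exI[where x = u])
qed

lemma closed_loop_unique:
  assumes causal: "\<And>u v t. (\<And>s. - int D \<le> s \<Longrightarrow> s < int t \<Longrightarrow> u s = v s) \<Longrightarrow> G u t = G v t"
    and "closed_loop G \<phi> u" "closed_loop G \<phi> v" and "- int D \<le> s"
  shows "u s = v s"
proof -
  have "u (int t) = v (int t)" for t
  proof (induction t rule: less_induct)
    case (less t)
    have "u s = v s" if "- int D \<le> s" "s < int t" for s
      using that less[of "nat s"] assms(2,3)
      by (cases "s < 0") (auto simp: closed_loop_def)
    from causal[OF this] show ?case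
      using assms(2,3) by (simp add: closed_loop_def)
  qed
  from this[of "nat s"] show ?thesis
    using assms(2-4) by (cases "s < 0") (auto simp: closed_loop_def)
qed

lemmas state_feedback_closed_loop_exists =
  closed_loop_exists[of "state_feedback K0 K x0" for K0 K x0, OF state_feedback_causal]

lemmas predictor_feedback_closed_loop_exists =
  closed_loop_exists[of "predictor_feedback L0 L x0" for L0 L x0, OF predictor_feedback_causal]

end

end

theory Submission
  imports Defs
begin

text \<open>
  The auxiliary state \<open>\<eta>\<^sub>t\<close> is \<open>x\<^sub>t\<close> plus past controls \<open>u\<^sub>t\<^sub>-\<^sub>\<tau>\<close> weighted by matrices
  \<open>A\<^sup>\<tau>\<^sup>-\<^sup>j\<^sup>-\<^sup>1 (B\<^sub>j + \<omega>\<^sup>j C\<^sub>j)\<close> whose noise has a time index at least \<open>t\<close>. That noise is independent of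
  \<open>\<F>\<^sub>t\<^sub>-\<^sub>1\<close> and has mean zero, while \<open>x\<^sub>t\<close> and the past controls are \<open>\<F>\<^sub>t\<^sub>-\<^sub>1\<close>-measurable and square
  integrable along either closed loop. Conditioning on \<open>\<F>\<^sub>t\<^sub>-\<^sub>1\<close> therefore just deletes the noise
  (\<open>aux_predictor_eq\<close>): almost surely the predictor is \<open>x\<^sub>t + \<Sum>\<^sub>\<tau> G\<^sub>\<tau> u\<^sub>t\<^sub>-\<^sub>\<tau>\<close> with
  \<open>G\<^sub>\<tau> = \<Sum>\<^sub>j A\<^sup>\<tau>\<^sup>-\<^sup>j\<^sup>-\<^sup>1 B\<^sub>j\<close> (\<open>predictor_gain\<close>).

  Hence a predictor feedback with gains \<open>L\<close> is, almost surely, the state feedback with gains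
  \<open>K\<^sub>0 = L\<^sub>0\<close> and \<open>K\<^sub>\<tau> = L\<^sub>\<tau> + L\<^sub>0 G\<^sub>\<tau>\<close>. This correspondence of gains is a bijection, and corresponding
  laws started from the same data generate the same process up to a null set
  (\<open>closed_loops_agree\<close>).

  It remains to compare the two notions of stability along one process. The difference
  \<open>\<eta>\<^sub>t - x\<^sub>t\<close> is a finite combination of the last \<open>D\<close> controls, each multiplied by random
  coefficients that are independent of it, so its second moment is bounded by a constant times the
  sum of the second moments of these controls.
  Admissibility makes the latter summable, hence they tend to zero, and \<open>\<eta>\<close> is stable if and only
  if \<open>x\<close> is (\<open>aux_state_stable_iff_state_stable\<close>). Both stability requirements include
  admissibility, so this is available in either direction.
\<close>

section \<open>Measurability of vector-valued functions\<close>

lemma borel_measurable_matrix_vector: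
  fixes P :: "real ^ 'k ^ 'l"
  assumes "X \<in> borel_measurable F"
  shows "(\<lambda>z. P *v X z) \<in> borel_measurable F"
  using assms
  by (rule measurable_compose)
    (intro borel_measurable_continuous_onI linear_continuous_on linear_linear[THEN iffD2] matrix_vector_mul_linear)

lemma borel_measurable_vec_nth:
  fixes X :: "'a \<Rightarrow> real ^ 'k"
  assumes "X \<in> borel_measurable F"
  shows "(\<lambda>z. X z $ i) \<in> borel_measurable F"
  using assms by (rule measurable_compose) (intro borel_measurable_continuous_onI continuous_intros)

lemma borel_measurable_vec_lambda:
  fixes X :: "'a \<Rightarrow> 'k::finite \<Rightarrow> real"
  assumes "\<And>i. (\<lambda>z. X z i) \<in> borel_measurable F"
  shows "(\<lambda>z. \<chi> i. X z i) \<in> borel_measurable F"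
  unfolding borel_measurable_euclidean_space[of "\<lambda>z. \<chi> i. X z i"]
  using assms by (auto simp: Basis_vec_def inner_axis)

context delay_system begin

section \<open>Future noise is independent of the past\<close>

lemma noise_measurable: "\<tau> \<le> D \<Longrightarrow> random_variable borel (\<omega> \<tau> t)"
  using integrable_noise by blast

text \<open>
  Independence of the channels as whole sequences and independence in time within each channel
  combine to independence of the doubly indexed family: a finite set of events splits by channel,
  each group is an event about one noise sequence, and the time independence factors it further.
\<close>

lemma indep_vars_noise: "indep_vars (\<lambda>_. borel) (\<lambda>(\<tau>, s). \<omega> \<tau> s) ({..D} \<times> UNIV)"
  unfolding indep_vars_def2
proof (intro conjI ballI)
  show "random_variable borel (case i of (\<tau>, s) \<Rightarrow> \<omega> \<tau> s)" if "i \<in> {..D} \<times> UNIV" for i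
    using that noise_measurable by auto
next
  show "indep_sets (\<lambda>i. {(case i of (\<tau>, s) \<Rightarrow> \<omega> \<tau> s) -` S \<inter> space M |S. S \<in> sets borel}) ({..D} \<times> UNIV)"
  proof (rule indep_setsI)
    fix i :: "nat \<times> nat" assume "i \<in> {..D} \<times> UNIV"
    then show "{(case i of (\<tau>, s) \<Rightarrow> \<omega> \<tau> s) -` S \<inter> space M |S. S \<in> sets borel} \<subseteq> events"
      using noise_measurable by (auto intro: measurable_sets)
  next
    fix E and J :: "(nat \<times> nat) set"
    assume J: "J \<noteq> {}" "J \<subseteq> {..D} \<times> UNIV" "finite J"
      and E: "\<forall>i\<in>J. E i \<in> {(case i of (\<tau>, s) \<Rightarrow> \<omega> \<tau> s) -` S \<inter> space M |S. S \<in> sets borel}"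
    define T where "T = fst ` J"
    define R where "R \<tau> = {s. (\<tau>, s) \<in> J}" for \<tau>
    have J_eq: "J = Sigma T R" by (force simp: T_def R_def)
    have finT: "finite T" and finR: "finite (R \<tau>)" for \<tau>
      using J(3) finite_vimageI[OF J(3), of "Pair \<tau>"] by (auto simp: T_def R_def vimage_def inj_on_def)
    have T: "T \<noteq> {}" "T \<subseteq> {..D}" and R: "\<tau> \<in> T \<Longrightarrow> R \<tau> \<noteq> {}" for \<tau>
      using J by (auto simp: T_def R_def)
    from E have "\<forall>i\<in>J. \<exists>S. S \<in> sets borel \<and> E i = (case i of (\<tau>, s) \<Rightarrow> \<omega> \<tau> s) -` S \<inter> space M"
      by blast
    then obtain S where S: "\<And>i. i \<in> J \<Longrightarrow> S i \<in> sets borel"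
      and ES: "\<And>i. i \<in> J \<Longrightarrow> E i = (case i of (\<tau>, s) \<Rightarrow> \<omega> \<tau> s) -` S i \<inter> space M"
      by metis
    \<comment> \<open>Group the events by channel: each group is one event about a whole noise sequence.\<close>
    define V where "V \<tau> = {f \<in> space (\<Pi>\<^sub>M t\<in>UNIV::nat set. (borel::real measure)). \<forall>s\<in>R \<tau>. f s \<in> S (\<tau>, s)}" for \<tau>
    have V: "V \<tau> \<in> sets (\<Pi>\<^sub>M t\<in>UNIV. borel)" if "\<tau> \<in> T" for \<tau>
      unfolding V_def
    proof (rule sets.sets_Collect_finite_All'[OF _ finR R[OF that]])
      fix s assume s: "s \<in> R \<tau>"
      have "(\<lambda>f. f s) \<in> measurable (\<Pi>\<^sub>M t\<in>UNIV::nat set. (borel::real measure)) borel" by measurable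
      from measurable_sets[OF this S] s
      show "{f \<in> space (\<Pi>\<^sub>M t\<in>UNIV. borel). f s \<in> S (\<tau>, s)} \<in> sets (\<Pi>\<^sub>M t\<in>UNIV. borel)"
        by (auto simp: R_def vimage_def Int_def conj_commute)
    qed
    have VE: "(\<lambda>z. \<lambda>t\<in>UNIV. \<omega> \<tau> t z) -` V \<tau> \<inter> space M = (\<Inter>s\<in>R \<tau>. E (\<tau>, s))" if "\<tau> \<in> T" for \<tau>
      using R[OF that] by (auto simp: V_def space_PiM ES R_def)
    have "prob (\<Inter>i\<in>J. E i) = prob (\<Inter>\<tau>\<in>T. \<Inter>s\<in>R \<tau>. E (\<tau>, s))"
      unfolding J_eq by (rule arg_cong[of _ _ prob]) auto
    also have "\<dots> = prob (\<Inter>\<tau>\<in>T. (\<lambda>z. \<lambda>t\<in>UNIV. \<omega> \<tau> t z) -` V \<tau> \<inter> space M)"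
      using VE by (intro arg_cong[of _ _ prob]) simp
    also have "\<dots> = (\<Prod>\<tau>\<in>T. prob ((\<lambda>z. \<lambda>t\<in>UNIV. \<omega> \<tau> t z) -` V \<tau> \<inter> space M))"
      by (rule indep_varsD[OF independent_channels]) (use T finT V in auto)
    also have "\<dots> = (\<Prod>\<tau>\<in>T. \<Prod>s\<in>R \<tau>. prob (E (\<tau>, s)))"
    proof (rule prod.cong[OF refl])
      fix \<tau> assume \<tau>: "\<tau> \<in> T"
      have "prob (\<Inter>s\<in>R \<tau>. \<omega> \<tau> s -` S (\<tau>, s) \<inter> space M) = (\<Prod>s\<in>R \<tau>. prob (\<omega> \<tau> s -` S (\<tau>, s) \<inter> space M))"
        by (rule indep_varsD[OF independent_in_time]) (use T R finR \<tau> S in \<open>auto simp: R_def\<close>)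
      then show "prob ((\<lambda>z. \<lambda>t\<in>UNIV. \<omega> \<tau> t z) -` V \<tau> \<inter> space M) = (\<Prod>s\<in>R \<tau>. prob (E (\<tau>, s)))"
        unfolding VE[OF \<tau>] by (simp add: ES R_def)
    qed
    also have "\<dots> = (\<Prod>i\<in>J. prob (E i))"
      unfolding J_eq using finT finR by (subst prod.Sigma) auto
    finally show "prob (\<Inter>i\<in>J. E i) = (\<Prod>i\<in>J. prob (E i))" .
  qed
qed

lemma space_filt [simp]: "space (filt t) = space M"
  by (simp add: filt_def space_measure_of_conv)

lemma sets_filt:
  "sets (filt t) = sigma_sets (space M)
     (\<Union>i\<in>{(\<tau>, s). \<tau> \<le> D \<and> int s \<le> t}. {(case i of (\<tau>, s) \<Rightarrow> \<omega> \<tau> s) -` S \<inter> space M | S. S \<in> sets borel})"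
proof -
  have "{\<omega> \<tau> s -` S \<inter> space M | \<tau> s S. \<tau> \<le> D \<and> int s \<le> t \<and> S \<in> sets borel} =
     (\<Union>i\<in>{(\<tau>, s). \<tau> \<le> D \<and> int s \<le> t}. {(case i of (\<tau>, s) \<Rightarrow> \<omega> \<tau> s) -` S \<inter> space M | S. S \<in> sets borel})"
    by (auto; blast)
  then show ?thesis
    unfolding filt_def by (subst sets_measure_of) auto
qed

lemma subalgebra_filt: "subalgebra M (filt t)"
  unfolding subalgebra_def sets_filt
  using noise_measurable by (auto intro!: sets.sigma_sets_subset intro: measurable_sets)

lemma filt_mono: "s \<le> t \<Longrightarrow> sets (filt s) \<subseteq> sets (filt t)"
  unfolding sets_filt by (intro sigma_sets_mono' UN_mono) auto

lemma measurable_filt_mono: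
  "f \<in> measurable (filt s) N \<Longrightarrow> s \<le> t \<Longrightarrow> f \<in> measurable (filt t) N"
  using filt_mono[of s t] by (auto simp: measurable_def)

lemma noise_measurable_filt:
  assumes "\<tau> \<le> D" "int s \<le> t"
  shows "\<omega> \<tau> s \<in> borel_measurable (filt t)"
proof (rule measurableI)
  fix S :: "real set" assume "S \<in> sets borel"
  then show "\<omega> \<tau> s -` S \<inter> space (filt t) \<in> sets (filt t)"
    unfolding sets_filt space_filt
    by (intro sigma_sets.Basic UN_I[of "(\<tau>, s)"]) (use assms in auto)
qed auto

text \<open>
  The sigma-algebra \<open>filt t\<close> and the variable \<open>\<omega> \<tau> s\<close> are generated by disjoint blocks of an
  independent family.
\<close>

lemma indep_var_noise_filt:
  assumes \<tau>: "\<tau> \<le> D" and t: "t < int s" and f: "f \<in> measurable (filt t) N"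
  shows "indep_var borel (\<omega> \<tau> s) N f"
proof -
  let ?E = "\<lambda>i. {(case i of (\<tau>, s) \<Rightarrow> \<omega> \<tau> s) -` S \<inter> space M | S. S \<in> sets borel}"
  let ?I = "case_bool {(\<tau>, s)} {(\<tau>, s). \<tau> \<le> D \<and> int s \<le> t}"
  have "indep_sets ?E ({..D} \<times> UNIV)"
    using indep_vars_noise by (simp add: indep_vars_def2)
  then have "indep_sets ?E (\<Union>b\<in>UNIV. ?I b)"
    by (rule indep_sets_mono_index[rotated]) (use \<tau> in \<open>auto split: bool.splits\<close>)
  then have *: "indep_sets (\<lambda>b. sigma_sets (space M) (\<Union>i\<in>?I b. ?E i)) UNIV"
  proof (rule indep_sets_collect_sigma)
    show "Int_stable (?E i)" for i
      unfolding Int_stable_def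
    proof clarify
      fix S T :: "real set" assume "S \<in> sets borel" "T \<in> sets borel"
      then show "\<exists>R. ((case i of (\<tau>, s) \<Rightarrow> \<omega> \<tau> s) -` S \<inter> space M) \<inter> ((case i of (\<tau>, s) \<Rightarrow> \<omega> \<tau> s) -` T \<inter> space M)
          = (case i of (\<tau>, s) \<Rightarrow> \<omega> \<tau> s) -` R \<inter> space M \<and> R \<in> sets borel"
        by (intro exI[of _ "S \<inter> T"]) auto
    qed
    show "disjoint_family_on ?I UNIV"
      using t by (auto simp: disjoint_family_on_def split: bool.splits)
  qed
  have "indep_set (sigma_sets (space M) (?E (\<tau>, s))) (sets (filt t))"
    unfolding indep_set_def
    by (rule indep_sets_mono_sets[OF *]) (auto simp: sets_filt split: bool.splits)
  moreover have "sigma_sets (space M) {f -` S \<inter> space M | S. S \<in> sets N} \<subseteq> sets (filt t)"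
    using sets.sigma_sets_subset[of "{f -` S \<inter> space M | S. S \<in> sets N}" "filt t"] measurable_sets[OF f]
    by auto
  ultimately have "indep_set (sigma_sets (space M) {\<omega> \<tau> s -` S \<inter> space M | S. S \<in> sets borel})
      (sigma_sets (space M) {f -` S \<inter> space M | S. S \<in> sets N})"
    unfolding indep_sets2_eq prod.case by (meson subset_eq)
  moreover have "random_variable N f"
    using f subalgebra_filt by (rule measurable_from_subalg[rotated])
  ultimately show ?thesis
    unfolding indep_var_eq using noise_measurable[OF \<tau>] by blast
qed

section \<open>Second moments\<close>

lemma measurable_filt_imp_measurable: "X \<in> measurable (filt t) N \<Longrightarrow> X \<in> measurable M N"
  using measurable_from_subalg subalgebra_filt by blast

lemma second_moment_cong_AE:
  "AE z in M. X z = Y z \<Longrightarrow> second_moment X = second_moment Y"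
  unfolding second_moment_def by (rule nn_integral_cong_AE) auto

text \<open>
  From \<open>0 \<le> \<bar>X - Y\<bar>\<^sup>2\<close>. Unlike Minkowski's inequality this bound is linear in the second moments,
  so it passes directly to finiteness and to limits.
\<close>

lemma second_moment_add_le:
  fixes X Y :: "'a \<Rightarrow> real ^ 'k"
  assumes X: "X \<in> borel_measurable M" and Y: "Y \<in> borel_measurable M"
  shows "second_moment (\<lambda>z. X z + Y z) \<le> 2 * second_moment X + 2 * second_moment Y"
proof -
  have "ennreal ((X z + Y z) \<bullet> (X z + Y z)) \<le> 2 * ennreal (X z \<bullet> X z) + 2 * ennreal (Y z \<bullet> Y z)" for z
  proof -
    have "0 \<le> (X z - Y z) \<bullet> (X z - Y z)" by simp
    then have "(X z + Y z) \<bullet> (X z + Y z) \<le> 2 * (X z \<bullet> X z) + 2 * (Y z \<bullet> Y z)"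
      by (simp add: inner_add inner_diff inner_commute)
    then have "ennreal ((X z + Y z) \<bullet> (X z + Y z)) \<le> ennreal (2 * (X z \<bullet> X z) + 2 * (Y z \<bullet> Y z))"
      by (rule ennreal_leI)
    then show ?thesis by (simp add: ennreal_plus ennreal_mult)
  qed
  then have "second_moment (\<lambda>z. X z + Y z) \<le> (\<integral>\<^sup>+ z. 2 * ennreal (X z \<bullet> X z) + 2 * ennreal (Y z \<bullet> Y z) \<partial>M)"
    unfolding second_moment_def by (rule nn_integral_mono)
  also have "\<dots> = 2 * second_moment X + 2 * second_moment Y"
    unfolding second_moment_def using X Y by (simp add: nn_integral_add nn_integral_cmult)
  finally show ?thesis .
qed

lemma second_moment_matrix_le:
  fixes P :: "real ^ 'k ^ 'l"
  assumes X: "X \<in> borel_measurable M"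
  shows "second_moment (\<lambda>z. P *v X z) \<le> ennreal ((onorm ((*v) P))\<^sup>2) * second_moment X"
proof -
  have "ennreal ((P *v X z) \<bullet> (P *v X z)) \<le> ennreal ((onorm ((*v) P))\<^sup>2) * ennreal (X z \<bullet> X z)" for z
  proof -
    have "norm (P *v X z) \<le> onorm ((*v) P) * norm (X z)"
      by (intro onorm linear_linear[THEN iffD2] matrix_vector_mul_linear)
    then have "(norm (P *v X z))\<^sup>2 \<le> (onorm ((*v) P) * norm (X z))\<^sup>2"
      by (rule power_mono) simp
    then show ?thesis
      by (simp add: ennreal_mult[symmetric] power_mult_distrib dot_square_norm ennreal_leI)
  qed
  then have "second_moment (\<lambda>z. P *v X z) \<le> (\<integral>\<^sup>+ z. ennreal ((onorm ((*v) P))\<^sup>2) * ennreal (X z \<bullet> X z) \<partial>M)"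
    unfolding second_moment_def by (rule nn_integral_mono)
  also have "\<dots> = ennreal ((onorm ((*v) P))\<^sup>2) * second_moment X"
    unfolding second_moment_def using X by (simp add: nn_integral_cmult)
  finally show ?thesis .
qed

text \<open>
  A coefficient that is independent of the past scales second moments exactly by its variance,
  because the nonnegative integral of a product of independent variables factors.
\<close>

lemma second_moment_noise:
  fixes X :: "'a \<Rightarrow> real ^ 'k"
  assumes \<tau>: "\<tau> \<le> D" and s: "t < int s" and X: "X \<in> borel_measurable (filt t)"
  shows "second_moment (\<lambda>z. \<omega> \<tau> s z *\<^sub>R X z) = ennreal ((\<sigma> \<tau>)\<^sup>2) * second_moment X"
proof -
  have "(\<lambda>z. X z \<bullet> X z) \<in> borel_measurable (filt t)"
    using X by measurable
  from indep_var_noise_filt[OF \<tau> s this]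
  have "indep_var borel ((\<lambda>w. ennreal (w * w)) \<circ> \<omega> \<tau> s) borel (ennreal \<circ> (\<lambda>z. X z \<bullet> X z))"
    by (rule indep_var_compose) auto
  then have "indep_vars (\<lambda>_. borel) (case_bool (\<lambda>z. ennreal (\<omega> \<tau> s z * \<omega> \<tau> s z)) (\<lambda>z. ennreal (X z \<bullet> X z))) UNIV"
    unfolding indep_var_def comp_def
    by (rule back_subst[of "\<lambda>N. indep_vars N _ _"]) (auto split: bool.splits)
  from indep_vars_nn_integral[OF _ this]
  have "(\<integral>\<^sup>+ z. ennreal (\<omega> \<tau> s z * \<omega> \<tau> s z) * ennreal (X z \<bullet> X z) \<partial>M)
      = (\<integral>\<^sup>+ z. ennreal (\<omega> \<tau> s z * \<omega> \<tau> s z) \<partial>M) * (\<integral>\<^sup>+ z. ennreal (X z \<bullet> X z) \<partial>M)"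
    by (simp add: UNIV_bool mult.commute split: bool.splits)
  moreover have "(\<integral>\<^sup>+ z. ennreal (\<omega> \<tau> s z * \<omega> \<tau> s z) \<partial>M) = ennreal ((\<sigma> \<tau>)\<^sup>2)"
    using nn_integral_eq_integral[OF integrable_noise_mult[OF \<tau>, of s s]] noise_covariance[OF \<tau>, of s s] by simp
  ultimately show ?thesis
    unfolding second_moment_def by (simp add: ennreal_mult[symmetric] mult.assoc)
qed

lemma expectation_noise_mult:
  fixes X :: "'a \<Rightarrow> real"
  assumes \<tau>: "\<tau> \<le> D" and s: "t < int s"
    and X: "X \<in> borel_measurable (filt t)" and int: "integrable M X"
  shows "integrable M (\<lambda>z. \<omega> \<tau> s z * X z)" and "expectation (\<lambda>z. \<omega> \<tau> s z * X z) = 0"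
  using indep_var_integrable[OF indep_var_noise_filt[OF \<tau> s X] integrable_noise[OF \<tau>] int]
    indep_var_lebesgue_integral[OF indep_var_noise_filt[OF \<tau> s X] integrable_noise[OF \<tau>] int]
    noise_mean[OF \<tau>] by auto

text \<open>
  The sigma-algebra \<open>F\<close> only restricts measurability; the second moment is always taken with
  respect to \<open>M\<close>.
\<close>

definition square_integrable :: "'a measure \<Rightarrow> ('a \<Rightarrow> real ^ 'k) \<Rightarrow> bool" where
  "square_integrable F X \<longleftrightarrow> X \<in> borel_measurable F \<and> second_moment X < \<infinity>"

lemma square_integrable_mono:
  "square_integrable (filt s) X \<Longrightarrow> s \<le> t \<Longrightarrow> square_integrable (filt t) X"
  using measurable_filt_mono by (auto simp: square_integrable_def)

lemma square_integrable_const: "square_integrable (filt t) (\<lambda>z. c)"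
  by (simp add: square_integrable_def second_moment_def emeasure_space_1)

lemma square_integrable_add:
  assumes "square_integrable (filt t) X" "square_integrable (filt t) Y"
  shows "square_integrable (filt t) (\<lambda>z. X z + Y z)"
proof -
  have "2 * second_moment X + 2 * second_moment Y < \<infinity>"
    using assms by (simp add: square_integrable_def ennreal_mult_less_top)
  moreover have "second_moment (\<lambda>z. X z + Y z) \<le> 2 * second_moment X + 2 * second_moment Y"
    using assms by (intro second_moment_add_le) (auto simp: square_integrable_def intro: measurable_filt_imp_measurable)
  ultimately show ?thesis
    using assms unfolding square_integrable_def by (auto intro: le_less_trans)
qed

lemma square_integrable_sum:
  assumes "\<And>i. i \<in> I \<Longrightarrow> square_integrable (filt t) (X i)"
  shows "square_integrable (filt t) (\<lambda>z. \<Sum>i\<in>I. X i z)"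
proof (cases "finite I")
  case True
  then show ?thesis using assms
    by induction (auto intro: square_integrable_add square_integrable_const)
qed (simp add: square_integrable_const)

lemma square_integrable_matrix:
  fixes P :: "real ^ 'k ^ 'l"
  assumes "square_integrable (filt t) X"
  shows "square_integrable (filt t) (\<lambda>z. P *v X z)"
proof -
  have "second_moment (\<lambda>z. P *v X z) \<le> ennreal ((onorm ((*v) P))\<^sup>2) * second_moment X"
    using assms by (intro second_moment_matrix_le) (auto simp: square_integrable_def intro: measurable_filt_imp_measurable)
  also have "\<dots> < \<infinity>"
    using assms by (simp add: square_integrable_def ennreal_mult_less_top)
  finally show ?thesis
    using assms by (simp add: square_integrable_def borel_measurable_matrix_vector)
qed

lemma square_integrable_noise:
  assumes "\<tau> \<le> D" "t < int s" "int s \<le> r" and X: "square_integrable (filt t) X"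
  shows "square_integrable (filt r) (\<lambda>z. \<omega> \<tau> s z *\<^sub>R X z)"
proof -
  have "X \<in> borel_measurable (filt r)"
    using X assms by (auto simp: square_integrable_def intro: measurable_filt_mono)
  then show ?thesis
    using assms noise_measurable_filt[of \<tau> s r]
    by (auto simp: square_integrable_def second_moment_noise ennreal_mult_less_top)
qed

lemma integrable_component:
  fixes X :: "'a \<Rightarrow> real ^ 'k"
  assumes "square_integrable (filt t) X"
  shows "integrable M (\<lambda>z. X z $ i)"
proof (rule square_integrable_imp_integrable)
  have X: "X \<in> borel_measurable M" and fin: "second_moment X < \<infinity>"
    using assms measurable_filt_imp_measurable by (auto simp: square_integrable_def)
  show "(\<lambda>z. X z $ i) \<in> borel_measurable M"
    using X by (rule borel_measurable_vec_nth)
  have "integrable M (\<lambda>z. X z \<bullet> X z)"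
    using X fin by (intro integrableI_nonneg) (auto simp: second_moment_def)
  then show "integrable M (\<lambda>z. (X z $ i)\<^sup>2)"
  proof (rule Bochner_Integration.integrable_bound)
    show "(\<lambda>z. (X z $ i)\<^sup>2) \<in> borel_measurable M"
      using borel_measurable_vec_nth[OF X] by measurable
    have "(x $ i)\<^sup>2 \<le> x \<bullet> x" for x :: "real ^ 'k"
      using component_le_norm_cart[of x i] by (metis dot_square_norm abs_norm_cancel abs_le_square_iff)
    then show "AE z in M. norm ((X z $ i)\<^sup>2) \<le> norm (X z \<bullet> X z)" by simp
  qed
qed

text \<open>
  The lemmas below transport the statement that a sequence of random vectors tends to zero in mean
  square through the operations from which \<open>\<eta> - x\<close> is built.
\<close>

lemma vanishing_add:
  fixes X Y :: "nat \<Rightarrow> 'a \<Rightarrow> real ^ 'k"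
  assumes "\<And>t. X t \<in> borel_measurable M" "\<And>t. Y t \<in> borel_measurable M"
    and "(\<lambda>t. second_moment (X t)) \<longlonglongrightarrow> 0" "(\<lambda>t. second_moment (Y t)) \<longlonglongrightarrow> 0"
  shows "(\<lambda>t. second_moment (\<lambda>z. X t z + Y t z)) \<longlonglongrightarrow> 0"
proof (rule tendsto_sandwich[of "\<lambda>_. 0"])
  show "\<forall>\<^sub>F t in sequentially. second_moment (\<lambda>z. X t z + Y t z) \<le> 2 * second_moment (X t) + 2 * second_moment (Y t)"
    using assms by (intro always_eventually allI second_moment_add_le)
  show "(\<lambda>t. 2 * second_moment (X t) + 2 * second_moment (Y t)) \<longlonglongrightarrow> 0"
    using tendsto_add[OF ennreal_tendsto_cmult[OF _ assms(3), of 2] ennreal_tendsto_cmult[OF _ assms(4), of 2]] by simp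
qed auto

lemma vanishing_sum:
  fixes X :: "'i \<Rightarrow> nat \<Rightarrow> 'a \<Rightarrow> real ^ 'k"
  assumes "\<And>i t. i \<in> I \<Longrightarrow> X i t \<in> borel_measurable M"
    and "\<And>i. i \<in> I \<Longrightarrow> (\<lambda>t. second_moment (X i t)) \<longlonglongrightarrow> 0"
  shows "(\<lambda>t. second_moment (\<lambda>z. \<Sum>i\<in>I. X i t z)) \<longlonglongrightarrow> 0"
proof (cases "finite I")
  case True
  then show ?thesis using assms
  proof induction
    case (insert i I)
    have "(\<lambda>t. second_moment (\<lambda>z. X i t z + (\<Sum>i\<in>I. X i t z))) \<longlonglongrightarrow> 0"
      using insert by (intro vanishing_add borel_measurable_sum) auto
    then show ?case using insert by simp
  qed (simp add: second_moment_def)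
qed (simp add: second_moment_def)

lemma vanishing_matrix:
  fixes P :: "real ^ 'k ^ 'l"
  assumes "\<And>t. X t \<in> borel_measurable M" and "(\<lambda>t::nat. second_moment (X t)) \<longlonglongrightarrow> 0"
  shows "(\<lambda>t. second_moment (\<lambda>z. P *v X t z)) \<longlonglongrightarrow> 0"
proof (rule tendsto_sandwich[of "\<lambda>_. 0"])
  show "\<forall>\<^sub>F t in sequentially. second_moment (\<lambda>z. P *v X t z) \<le> ennreal ((onorm ((*v) P))\<^sup>2) * second_moment (X t)"
    using assms by (intro always_eventually allI second_moment_matrix_le)
  show "(\<lambda>t. ennreal ((onorm ((*v) P))\<^sup>2) * second_moment (X t)) \<longlonglongrightarrow> 0"
    using ennreal_tendsto_cmult[OF _ assms(2)] by simp
qed auto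

lemma second_moment_summable_imp_tendsto:
  assumes fin: "(\<Sum>t::nat. second_moment (X t)) < \<infinity>"
  shows "(\<lambda>t. second_moment (X t)) \<longlonglongrightarrow> 0"
proof -
  have top: "second_moment (X t) < top" for t
    using fin ennreal_suminf_lessD by fastforce
  then have eq: "second_moment (X t) = ennreal (enn2real (second_moment (X t)))" for t
    by (simp add: ennreal_enn2real)
  have "summable (\<lambda>t. enn2real (second_moment (X t)))"
    using fin eq by (intro summable_suminf_not_top) auto
  then have "(\<lambda>t. ennreal (enn2real (second_moment (X t)))) \<longlonglongrightarrow> 0"
    by (intro tendsto_ennrealI[of _ 0, simplified] summable_LIMSEQ_zero)
  then show ?thesis using eq by simp
qed

lemma vanishing_noise:
  fixes X :: "nat \<Rightarrow> 'a \<Rightarrow> real ^ 'k"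
  assumes "\<tau> \<le> D" "\<And>t. t \<le> k t" "\<And>t. X t \<in> borel_measurable (filt (int t - 1))"
    and "(\<lambda>t. second_moment (X t)) \<longlonglongrightarrow> 0"
  shows "(\<lambda>t. second_moment (\<lambda>z. \<omega> \<tau> (k t) z *\<^sub>R X t z)) \<longlonglongrightarrow> 0"
proof -
  have "int t - 1 < int (k t)" for t
    using assms(2)[of t] by linarith
  then have "second_moment (\<lambda>z. \<omega> \<tau> (k t) z *\<^sub>R X t z) = ennreal ((\<sigma> \<tau>)\<^sup>2) * second_moment (X t)" for t
    by (rule second_moment_noise[OF assms(1) _ assms(3)])
  then show ?thesis
    using ennreal_tendsto_cmult[OF _ assms(4), of "ennreal ((\<sigma> \<tau>)\<^sup>2)"] by simp
qed

section \<open>The predictor of the auxiliary state\<close>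

text \<open>
  The matrix \<open>G\<^sub>\<tau>\<close> with which \<open>u\<^sub>t\<^sub>-\<^sub>\<tau>\<close> enters the predictor.
\<close>

definition predictor_gain :: "nat \<Rightarrow> real ^ 'm ^ 'n" where
  "predictor_gain \<tau> = (\<Sum>j=\<tau>..D. mat_powi A (int \<tau> - int j - 1) ** B j)"

definition predicted_offset :: "(int \<Rightarrow> 'a \<Rightarrow> real ^ 'm) \<Rightarrow> nat \<Rightarrow> 'a \<Rightarrow> real ^ 'n" where
  "predicted_offset u t z = (\<Sum>\<tau>=1..D. predictor_gain \<tau> *v u (int t - int \<tau>) z)"

definition prediction_error :: "(int \<Rightarrow> 'a \<Rightarrow> real ^ 'm) \<Rightarrow> nat \<Rightarrow> 'a \<Rightarrow> real ^ 'n" where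
  "prediction_error u t z = (\<Sum>\<tau>=1..D. \<Sum>j=\<tau>..D. \<omega> j (t + j - \<tau>) z *\<^sub>R
     ((mat_powi A (int \<tau> - int j - 1) ** C j) *v u (int t - int \<tau>) z))"

text \<open>
  The first two summands are known at time \<open>t - 1\<close>; the last one is linear in noise that is still
  in the future at that time.
\<close>

lemma aux_state_decomposition:
  "aux_state x0 u t z = (state x0 u t z + predicted_offset u t z) + prediction_error u t z"
proof -
  have sum_mult: "(\<Sum>j\<in>J. X j) *v y = (\<Sum>j\<in>J. X j *v y)" if "finite J"
    for J :: "nat set" and X :: "nat \<Rightarrow> real ^ 'm ^ 'n" and y
    using that by induction (auto simp: matrix_vector_mult_add_rdistrib)
  have scale: "P ** (w *\<^sub>R Q) = w *\<^sub>R (P ** Q)" for P :: "real ^ 'n ^ 'n" and Q :: "real ^ 'm ^ 'n" and w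
    by (simp add: matrix_matrix_mult_def vec_eq_iff sum_distrib_left mult_ac)
  show ?thesis
    unfolding aux_state_def predicted_offset_def prediction_error_def predictor_gain_def
    by (simp add: sum_mult matrix_add_ldistrib matrix_vector_mult_add_rdistrib scale
        scaleR_matrix_vector_assoc sum.distrib)
qed

text \<open>
  Predictability with finite second moments, for the times in \<open>[- D, t)\<close>. The value at \<open>s\<close> must be
  measurable one step earlier than admissibility asks: the delay-free channel multiplies \<open>u\<^sub>t\<close> by
  \<open>\<omega>\<^sub>t\<^sup>0\<close>, which is independent of \<open>\<F>\<^sub>t\<^sub>-\<^sub>1\<close> but in general not of \<open>\<F>\<^sub>t\<close>.
\<close>

definition predictable_below :: "int \<Rightarrow> (int \<Rightarrow> 'a \<Rightarrow> real ^ 'm) \<Rightarrow> bool" where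
  "predictable_below t u \<longleftrightarrow> (\<forall>s. - int D \<le> s \<longrightarrow> s < t \<longrightarrow> square_integrable (filt (s - 1)) (u s))"

lemma predictable_belowD:
  assumes "predictable_below t u" "- int D \<le> s" "s < t" "s - 1 \<le> r"
  shows "square_integrable (filt r) (u s)"
  using assms square_integrable_mono by (auto simp: predictable_below_def)

lemma square_integrable_state:
  assumes "predictable_below (int t) u"
  shows "square_integrable (filt (int t - 1)) (state x0 u t)"
  using assms
proof (induction t)
  case 0
  then show ?case by (simp add: square_integrable_const)
next
  case (Suc t)
  have "predictable_below (int t) u"
    using Suc.prems by (auto simp: predictable_below_def)
  with Suc.IH have X: "square_integrable (filt (int t)) (state x0 u t)"
    using square_integrable_mono[of "int t - 1" _ "int t"] by auto
  have "square_integrable (filt (int t)) (\<lambda>z. (B \<tau> + \<omega> \<tau> t z *\<^sub>R C \<tau>) *v u (int t - int \<tau>) z)"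
    if "\<tau> \<in> {0..D}" for \<tau>
  proof -
    have "square_integrable (filt (int t)) (u (int t - int \<tau>))"
      "square_integrable (filt (int t - 1)) (u (int t - int \<tau>))"
      using that by (auto intro!: predictable_belowD[OF Suc.prems])
    then have "square_integrable (filt (int t)) (\<lambda>z. B \<tau> *v u (int t - int \<tau>) z + \<omega> \<tau> t z *\<^sub>R (C \<tau> *v u (int t - int \<tau>) z))"
      using that by (intro square_integrable_add square_integrable_noise[where t = "int t - 1"] square_integrable_matrix) auto
    then show ?thesis
      by (simp add: matrix_vector_mult_add_rdistrib scaleR_matrix_vector_assoc)
  qed
  with X show ?case
    by (auto intro!: square_integrable_add square_integrable_matrix square_integrable_sum)
qed

lemma square_integrable_predicted_offset:
  assumes "predictable_below (int t) u"
  shows "square_integrable (filt (int t - 1)) (predicted_offset u t)"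
  unfolding predicted_offset_def[abs_def]
  by (intro square_integrable_sum square_integrable_matrix predictable_belowD[OF assms]) auto

text \<open>
  Each summand is a product of a noise variable of time at least \<open>t\<close> and an integrable factor that
  is measurable at time \<open>t - 1\<close>; the indicator of \<open>S\<close> can be absorbed into the second factor.
\<close>

lemma expectation_prediction_error:
  assumes u: "predictable_below (int t) u" and S: "S \<in> sets (filt (int t - 1))"
  shows "integrable M (\<lambda>z. indicator S z * prediction_error u t z $ i)"
    and "expectation (\<lambda>z. indicator S z * prediction_error u t z $ i) = 0"
proof -
  define Y where "Y \<tau> j z = indicator S z * ((mat_powi A (int \<tau> - int j - 1) ** C j) *v u (int t - int \<tau>) z) $ i"
    for \<tau> j z
  have "has_bochner_integral M (\<lambda>z. \<omega> j (t + j - \<tau>) z * Y \<tau> j z) 0"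
    if "\<tau> \<in> {1..D}" "j \<in> {\<tau>..D}" for \<tau> j
  proof -
    have sq: "square_integrable (filt (int t - 1)) (\<lambda>z. (mat_powi A (int \<tau> - int j - 1) ** C j) *v u (int t - int \<tau>) z)"
      using that by (intro square_integrable_matrix predictable_belowD[OF u]) auto
    have "S \<in> events" using S subalgebra_filt by (auto simp: subalgebra_def)
    then have "integrable M (Y \<tau> j)"
      unfolding Y_def using integrable_mult_indicator[OF _ integrable_component[OF sq]] by simp
    moreover have "Y \<tau> j \<in> borel_measurable (filt (int t - 1))"
      unfolding Y_def using S sq
      by (intro borel_measurable_times borel_measurable_vec_nth) (auto simp: square_integrable_def)
    ultimately show ?thesis
      using that expectation_noise_mult[of j "int t - 1" "t + j - \<tau>" "Y \<tau> j"]
      by (auto simp: has_bochner_integral_iff)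
  qed
  then have "has_bochner_integral M (\<lambda>z. \<Sum>\<tau>=1..D. \<Sum>j=\<tau>..D. \<omega> j (t + j - \<tau>) z * Y \<tau> j z)
      (\<Sum>\<tau>=1..D. \<Sum>j=\<tau>..D. 0)"
    by (intro has_bochner_integral_sum) auto
  moreover have "indicator S z * prediction_error u t z $ i = (\<Sum>\<tau>=1..D. \<Sum>j=\<tau>..D. \<omega> j (t + j - \<tau>) z * Y \<tau> j z)" for z
    by (simp add: prediction_error_def Y_def sum_distrib_left mult_ac)
  ultimately show "integrable M (\<lambda>z. indicator S z * prediction_error u t z $ i)"
    and "expectation (\<lambda>z. indicator S z * prediction_error u t z $ i) = 0"
    by (simp_all add: has_bochner_integral_iff)
qed

text \<open>
  The prediction error has integral zero over every event of \<open>filt (t - 1)\<close>, so the remaining part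
  of the auxiliary state satisfies the defining property of the conditional expectation.
\<close>

lemma aux_predictor_eq:
  assumes u: "predictable_below (int t) u"
  shows "AE z in M. aux_predictor x0 u t z = state x0 u t z + predicted_offset u t z"
proof -
  interpret F: finite_measure_subalgebra M "filt (int t - 1)"
    by unfold_locales (rule subalgebra_filt)
  let ?g = "\<lambda>z. state x0 u t z + predicted_offset u t z"
  have g: "square_integrable (filt (int t - 1)) ?g"
    using square_integrable_add[OF square_integrable_state square_integrable_predicted_offset] u by blast
  have inn: "integrable M (\<lambda>z. prediction_error u t z $ i)" for i
    using expectation_prediction_error(1)[OF u sets.top, of i]
    by (rule Bochner_Integration.integrable_cong[THEN iffD1, rotated -1]) auto
  have "AE z in M. real_cond_exp M (filt (int t - 1)) (\<lambda>z. aux_state x0 u t z $ i) z = ?g z $ i" for i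
  proof (rule F.real_cond_exp_charact)
    show int_g: "integrable M (\<lambda>z. ?g z $ i)"
      using g by (rule integrable_component)
    show "integrable M (\<lambda>z. aux_state x0 u t z $ i)"
      unfolding aux_state_decomposition using int_g inn by simp
    show "(\<lambda>z. ?g z $ i) \<in> borel_measurable (filt (int t - 1))"
      using g by (intro borel_measurable_vec_nth) (simp add: square_integrable_def)
    fix S assume S: "S \<in> sets (filt (int t - 1))"
    then have "S \<in> events" using subalgebra_filt by (auto simp: subalgebra_def)
    then have "integrable M (\<lambda>z. indicator S z * ?g z $ i)"
      using integrable_mult_indicator[OF _ int_g] by simp
    then have "expectation (\<lambda>z. indicator S z * ?g z $ i + indicator S z * prediction_error u t z $ i)
        = expectation (\<lambda>z. indicator S z * ?g z $ i)"
      using expectation_prediction_error[OF u S, of i] by (subst Bochner_Integration.integral_add) auto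
    then show "(LINT z:S|M. aux_state x0 u t z $ i) = (LINT z:S|M. ?g z $ i)"
      by (simp add: set_lebesgue_integral_def aux_state_decomposition distrib_left)
  qed
  then have "AE z in M. \<forall>i. real_cond_exp M (filt (int t - 1)) (\<lambda>z. aux_state x0 u t z $ i) z = ?g z $ i"
    by (intro AE_finite_allI[of UNIV, simplified]) auto
  then show ?thesis
    by (auto simp: aux_predictor_def vec_eq_iff)
qed

section \<open>Comparison of the two closed loops\<close>

text \<open>
  Applies to both feedback laws: a law that turns predictable controls before time \<open>t\<close> into a
  predictable value at \<open>t\<close> propagates predictability from the deterministic initial data.
\<close>

lemma predictable_closed_loop:
  assumes cl: "closed_loop G \<phi> u"
    and step: "\<And>t. predictable_below (int t) u \<Longrightarrow> square_integrable (filt (int t - 1)) (G u t)"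
  shows "predictable_below (int t) u"
proof (induction t)
  case 0
  have "u s = (\<lambda>z. \<phi> s)" if "- int D \<le> s" "s < 0" for s
    using cl that by (auto simp: closed_loop_def)
  then show ?case
    by (auto simp: predictable_below_def square_integrable_const)
next
  case (Suc t)
  have "square_integrable (filt (int t - 1)) (u (int t))"
    using step[OF Suc.IH] cl by (simp add: closed_loop_def)
  moreover have "s = int t \<or> s < int t" if "s < int (Suc t)" for s
    using that by linarith
  ultimately show ?case
    using Suc.IH unfolding predictable_below_def by blast
qed

lemma square_integrable_state_feedback:
  assumes u: "predictable_below (int t) u"
  shows "square_integrable (filt (int t - 1)) (state_feedback K0 K x0 u t)"
  unfolding state_feedback_def
  by (intro square_integrable_add square_integrable_sum square_integrable_matrix
      square_integrable_state[OF u] predictable_belowD[OF u]) auto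

lemma predictor_feedback_eq_state_feedback:
  assumes u: "predictable_below (int t) u"
    and K: "\<And>\<tau>. K \<tau> = L \<tau> + L0 ** predictor_gain \<tau>"
  shows "AE z in M. predictor_feedback L0 L x0 u t z = state_feedback L0 K x0 u t z"
  using aux_predictor_eq[OF u, of x0]
proof eventually_elim
  case (elim z)
  have mult_sum: "P *v (\<Sum>j\<in>J. X j) = (\<Sum>j\<in>J. P *v X j)" if "finite J"
    for J :: "nat set" and X and P :: "real ^ 'n ^ 'm"
    using that by induction (auto simp: matrix_vector_right_distrib)
  show ?case
    unfolding predictor_feedback_def state_feedback_def elim predicted_offset_def K
    by (simp add: matrix_vector_right_distrib mult_sum matrix_vector_mult_add_rdistrib
        matrix_vector_mul_assoc sum.distrib)
qed

text \<open>
  Measurability holds for the predictor feedback itself because conditional expectations are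
  genuinely measurable with respect to the smaller sigma-algebra; only the second moment is taken
  from the almost surely equal state feedback.
\<close>

lemma square_integrable_predictor_feedback:
  assumes u: "predictable_below (int t) u"
  shows "square_integrable (filt (int t - 1)) (predictor_feedback L0 L x0 u t)"
proof -
  let ?K = "\<lambda>\<tau>. L \<tau> + L0 ** predictor_gain \<tau>"
  have "second_moment (predictor_feedback L0 L x0 u t) = second_moment (state_feedback L0 ?K x0 u t)"
    by (rule second_moment_cong_AE[OF predictor_feedback_eq_state_feedback[OF u]]) simp
  also have "\<dots> < \<infinity>"
    using square_integrable_state_feedback[OF u] by (simp add: square_integrable_def)
  finally have fin: "second_moment (predictor_feedback L0 L x0 u t) < \<infinity>" .
  have "u (int t - int \<tau>) \<in> borel_measurable (filt (int t - 1))" if "\<tau> \<in> {1..D}" for \<tau>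
    using predictable_belowD[OF u, of "int t - int \<tau>" "int t - 1"] that
    by (auto simp: square_integrable_def)
  then have "predictor_feedback L0 L x0 u t \<in> borel_measurable (filt (int t - 1))"
    unfolding predictor_feedback_def aux_predictor_def
    by (intro borel_measurable_add borel_measurable_sum borel_measurable_matrix_vector
        borel_measurable_vec_lambda borel_measurable_cond_exp)
  with fin show ?thesis by (simp add: square_integrable_def)
qed

lemma state_local:
  assumes "\<And>s. - int D \<le> s \<Longrightarrow> s < int t \<Longrightarrow> u s z = v s z"
  shows "state x0 u t z = state x0 v t z"
  using assms by (induction t) (auto intro!: sum.cong)

text \<open>
  Uniqueness for a single outcome \<open>z\<close>. The pathwise form is what allows the almost sure identities
  of the individual times to be combined into one null set.
\<close>

lemma state_feedback_solution_unique:
  assumes init: "\<And>s. - int D \<le> s \<Longrightarrow> s < 0 \<Longrightarrow> u s z = v s z"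
    and u: "\<And>t. u (int t) z = state_feedback K0 K x0 u t z"
    and v: "\<And>t. v (int t) z = state_feedback K0 K x0 v t z"
  shows "- int D \<le> s \<Longrightarrow> u s z = v s z"
proof (induction "nat (s + int D)" arbitrary: s rule: less_induct)
  case less
  show ?case
  proof (cases "s < 0")
    case True
    then show ?thesis using init less.prems by blast
  next
    case False
    then obtain t where t: "s = int t" by (metis int_nat_eq linorder_not_less zero_le_imp_eq_int)
    have past: "u r z = v r z" if "- int D \<le> r" "r < int t" for r
      using less.hyps[of r] that t by auto
    have "state_feedback K0 K x0 u t z = state_feedback K0 K x0 v t z"
      using state_local[of t u z v x0] past by (auto simp: state_feedback_def intro!: sum.cong)
    then show ?thesis using u v t by simp
  qed
qed

lemma closed_loops_agree:
  assumes u: "closed_loop (predictor_feedback L0 L x0) \<phi> u"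
    and v: "closed_loop (state_feedback L0 K x0) \<phi> v"
    and K: "\<And>\<tau>. K \<tau> = L \<tau> + L0 ** predictor_gain \<tau>"
  shows "AE z in M. \<forall>s\<ge>- int D. u s z = v s z"
proof -
  have "AE z in M. u (int t) z = state_feedback L0 K x0 u t z" for t
    using predictor_feedback_eq_state_feedback[OF predictable_closed_loop[OF u
        square_integrable_predictor_feedback] K] u by (simp add: closed_loop_def)
  then have "AE z in M. \<forall>t. u (int t) z = state_feedback L0 K x0 u t z"
    by (simp add: AE_all_countable)
  then show ?thesis
  proof eventually_elim
    case (elim z)
    show ?case
    proof (intro allI impI)
      fix s assume s: "- int D \<le> s"
      show "u s z = v s z"
      proof (rule state_feedback_solution_unique[OF _ _ _ s])
        show "u s z = v s z" if "- int D \<le> s" "s < 0" for s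
          using u v that by (simp add: closed_loop_def)
        show "v (int t) z = state_feedback L0 K x0 v t z" for t
          using v by (metis closed_loop_def)
      qed (use elim in blast)
    qed
  qed
qed

lemma vanishing_past_controls:
  assumes u: "\<And>t. predictable_below (int t) u"
    and fin: "(\<Sum>t::nat. second_moment (u (int t))) < \<infinity>"
  shows "(\<lambda>t. second_moment (\<lambda>z. predicted_offset u t z + prediction_error u t z)) \<longlonglongrightarrow> 0"
proof -
  have meas: "u (int t - int \<tau>) \<in> borel_measurable (filt (int t - 1))" if "\<tau> \<in> {1..D}" for \<tau> t
    using predictable_belowD[OF u, of "int t - int \<tau>" t "int t - 1"] that
    by (auto simp: square_integrable_def)
  have lim: "(\<lambda>t. second_moment (u (int t - int \<tau>))) \<longlonglongrightarrow> 0" for \<tau>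
  proof (rule LIMSEQ_offset)
    show "(\<lambda>t. second_moment (u (int (t + \<tau>) - int \<tau>))) \<longlonglongrightarrow> 0"
      using second_moment_summable_imp_tendsto[OF fin] by simp
  qed
  have gain_meas: "(\<lambda>z. P *v u (int t - int \<tau>) z) \<in> borel_measurable (filt (int t - 1))"
    if "\<tau> \<in> {1..D}" for \<tau> t and P :: "real ^ 'm ^ 'n"
    using meas[OF that] by (rule borel_measurable_matrix_vector)
  have gain_lim: "(\<lambda>t. second_moment (\<lambda>z. P *v u (int t - int \<tau>) z)) \<longlonglongrightarrow> 0"
    if "\<tau> \<in> {1..D}" for \<tau> and P :: "real ^ 'm ^ 'n"
    using meas[OF that] lim by (intro vanishing_matrix measurable_filt_imp_measurable)
  have noise_meas: "(\<lambda>z. \<omega> j (t + j - \<tau>) z *\<^sub>R (P *v u (int t - int \<tau>) z)) \<in> borel_measurable M"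
    if "\<tau> \<in> {1..D}" "j \<in> {\<tau>..D}" for \<tau> j t and P :: "real ^ 'm ^ 'n"
    using that noise_measurable measurable_filt_imp_measurable[OF gain_meas]
    by (intro borel_measurable_scaleR) auto
  show ?thesis
    unfolding predicted_offset_def prediction_error_def
    by (intro vanishing_add vanishing_sum borel_measurable_sum gain_lim vanishing_noise gain_meas
        noise_meas measurable_filt_imp_measurable[OF gain_meas]) auto
qed

lemma aux_state_stable_iff_state_stable:
  assumes u: "\<And>t. predictable_below (int t) u"
    and fin: "(\<Sum>t::nat. second_moment (u (int t))) < \<infinity>"
  shows "(\<lambda>t. second_moment (aux_state x0 u t)) \<longlonglongrightarrow> 0 \<longleftrightarrow> (\<lambda>t. second_moment (state x0 u t)) \<longlonglongrightarrow> 0"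
proof -
  let ?Y = "\<lambda>t z. predicted_offset u t z + prediction_error u t z"
  have X: "state x0 u t \<in> borel_measurable M" for t
    using square_integrable_state[OF u, of t x0] by (auto simp: square_integrable_def intro: measurable_filt_imp_measurable)
  have "u (int t - int \<tau>) \<in> borel_measurable M" if "\<tau> \<in> {1..D}" for \<tau> t
    using predictable_belowD[OF u, of "int t - int \<tau>" t "int t - 1"] that measurable_filt_imp_measurable
    by (auto simp: square_integrable_def)
  then have Y: "?Y t \<in> borel_measurable M" for t
    unfolding predicted_offset_def prediction_error_def
    by (intro borel_measurable_add borel_measurable_sum borel_measurable_scaleR borel_measurable_matrix_vector)
      (auto intro: noise_measurable)
  have eta: "aux_state x0 u t = (\<lambda>z. state x0 u t z + ?Y t z)" for t
    by (simp add: aux_state_decomposition fun_eq_iff add.assoc)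
  have neg: "second_moment (\<lambda>z. - ?Y t z) = second_moment (?Y t)" for t
    unfolding second_moment_def inner_minus_left inner_minus_right minus_minus
    by (rule refl)
  have state_eq: "state x0 u t = (\<lambda>z. aux_state x0 u t z + - ?Y t z)" for t
    by (simp add: eta)
  show ?thesis
  proof
    assume lim: "(\<lambda>t. second_moment (aux_state x0 u t)) \<longlonglongrightarrow> 0"
    have "aux_state x0 u t \<in> borel_measurable M" for t
      unfolding eta using X Y by (rule borel_measurable_add)
    moreover have "(\<lambda>z. - ?Y t z) \<in> borel_measurable M" for t
      using Y by (rule borel_measurable_uminus)
    moreover have "(\<lambda>t. second_moment (\<lambda>z. - ?Y t z)) \<longlonglongrightarrow> 0"
      unfolding neg using vanishing_past_controls[OF u fin] .
    ultimately have "(\<lambda>t. second_moment (\<lambda>z. aux_state x0 u t z + - ?Y t z)) \<longlonglongrightarrow> 0"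
      using lim by (intro vanishing_add)
    then show "(\<lambda>t. second_moment (state x0 u t)) \<longlonglongrightarrow> 0"
      unfolding state_eq .
  next
    assume "(\<lambda>t. second_moment (state x0 u t)) \<longlonglongrightarrow> 0"
    then show "(\<lambda>t. second_moment (aux_state x0 u t)) \<longlonglongrightarrow> 0"
      unfolding eta using vanishing_past_controls[OF u fin]
      by (rule vanishing_add[where X = "state x0 u", OF X Y])
  qed
qed

lemma U_ad_iff_summable:
  assumes u: "\<And>t. predictable_below (int t) u"
    and law: "\<And>t. AE z in M. u (int t) z = state_feedback K0 K x0 u t z"
  shows "u \<in> U_ad x0 \<longleftrightarrow> (\<Sum>t::nat. second_moment (u (int t))) < \<infinity>"
proof -
  have "u (int t) \<in> borel_measurable (filt (int t))" for t
    using predictable_belowD[OF u, of "int t" "Suc t" "int t"] by (auto simp: square_integrable_def)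
  then show ?thesis
    using law by (auto simp: U_ad_def)
qed

text \<open>
  The theorem for one pair of corresponding gains and one choice of initial data. What remains
  afterwards is that the correspondence of gains can be solved for either side and that both closed
  loops have solutions.
\<close>

lemma predictor_loop_iff_state_loop:
  assumes inv: "invertible A"
    and u: "closed_loop (predictor_feedback L0 L x0) \<phi> u"
    and v: "closed_loop (state_feedback L0 K x0) \<phi> v"
    and K: "\<And>\<tau>. K \<tau> = L \<tau> + L0 ** predictor_gain \<tau>"
  shows "u \<in> U_ad x0 \<and> (\<lambda>t. second_moment (aux_system (aux_state x0 u 0) u t)) \<longlonglongrightarrow> 0
    \<longleftrightarrow> v \<in> U_ad x0 \<and> (\<lambda>t. second_moment (state x0 v t)) \<longlonglongrightarrow> 0"
proof -
  have pu: "predictable_below (int t) u" for t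
    using u square_integrable_predictor_feedback by (rule predictable_closed_loop)
  have pv: "predictable_below (int t) v" for t
    using v square_integrable_state_feedback by (rule predictable_closed_loop)
  have lu: "AE z in M. u (int t) z = state_feedback L0 K x0 u t z" for t
    using predictor_feedback_eq_state_feedback[OF pu K] u by (simp add: closed_loop_def)
  have lv: "AE z in M. v (int t) z = state_feedback L0 K x0 v t z" for t
    using v by (auto simp: closed_loop_def)
  note agree = closed_loops_agree[OF u v K]
  have "second_moment (u (int t)) = second_moment (v (int t))" for t
    using agree by (intro second_moment_cong_AE) (auto elim!: eventually_mono)
  then have U: "u \<in> U_ad x0 \<longleftrightarrow> v \<in> U_ad x0"
    by (simp add: U_ad_iff_summable[OF pu lu] U_ad_iff_summable[OF pv lv])
  have X: "second_moment (state x0 u t) = second_moment (state x0 v t)" for t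
    using agree by (intro second_moment_cong_AE) (auto elim!: eventually_mono intro!: state_local)
  show ?thesis
    using U X aux_state_stable_iff_state_stable[OF pu] U_ad_iff_summable[OF pu lu]
    by (auto simp: aux_system_eq_aux_state[OF inv])
qed

end

theorem lemma1:
  fixes M :: "'a measure"
    and D :: nat
    and \<sigma> :: "nat \<Rightarrow> real"
    and \<omega> :: "nat \<Rightarrow> nat \<Rightarrow> 'a \<Rightarrow> real"
    and A :: "real ^ 'n ^ 'n"
    and B C :: "nat \<Rightarrow> real ^ 'm ^ 'n"
  assumes "delay_system M D \<sigma> \<omega>"
    and "invertible A"
  shows "delay_system.ms_stabilizable M D \<omega> A B C \<longleftrightarrow>
    (\<exists>(L0 :: real ^ 'n ^ 'm) (L :: nat \<Rightarrow> real ^ 'm ^ 'm).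
       \<forall>(x0 :: real ^ 'n) (\<phi> :: int \<Rightarrow> real ^ 'm) (u :: int \<Rightarrow> 'a \<Rightarrow> real ^ 'm).
         delay_system.closed_loop D (delay_system.predictor_feedback M D \<omega> A B C L0 L x0) \<phi> u \<longrightarrow>
           u \<in> delay_system.U_ad M D \<omega> A B C x0 \<and>
           (\<lambda>t. delay_system.second_moment M
                  (delay_system.aux_system D \<omega> A B C (delay_system.aux_state D \<omega> A B C x0 u 0) u t))
             \<longlonglongrightarrow> 0)"
proof -
  interpret delay_system M D \<sigma> \<omega> A B C by (rule assms(1))
  note corr = predictor_loop_iff_state_loop[OF assms(2)]
  show ?thesis
    unfolding ms_stabilizable_def
  proof (intro iffI; elim exE)
    fix K0 and K :: "nat \<Rightarrow> real ^ 'm ^ 'm"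
    assume stab: "\<forall>x0 \<phi> u. closed_loop (state_feedback K0 K x0) \<phi> u \<longrightarrow>
      u \<in> U_ad x0 \<and> (\<lambda>t. second_moment (state x0 u t)) \<longlonglongrightarrow> 0"
    let ?L = "\<lambda>\<tau>. K \<tau> - K0 ** predictor_gain \<tau>"
    have "u \<in> U_ad x0 \<and> (\<lambda>t. second_moment (aux_system (aux_state x0 u 0) u t)) \<longlonglongrightarrow> 0"
      if u: "closed_loop (predictor_feedback K0 ?L x0) \<phi> u" for x0 \<phi> u
    proof -
      obtain v where v: "closed_loop (state_feedback K0 K x0) \<phi> v"
        using state_feedback_closed_loop_exists by blast
      with stab show ?thesis using corr[OF u v] by simp
    qed
    then show "\<exists>L0 L. \<forall>x0 \<phi> u. closed_loop (predictor_feedback L0 L x0) \<phi> u \<longrightarrow>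
        u \<in> U_ad x0 \<and> (\<lambda>t. second_moment (aux_system (aux_state x0 u 0) u t)) \<longlonglongrightarrow> 0"
      by blast
  next
    fix L0 and L :: "nat \<Rightarrow> real ^ 'm ^ 'm"
    assume stab: "\<forall>x0 \<phi> u. closed_loop (predictor_feedback L0 L x0) \<phi> u \<longrightarrow>
      u \<in> U_ad x0 \<and> (\<lambda>t. second_moment (aux_system (aux_state x0 u 0) u t)) \<longlonglongrightarrow> 0"
    let ?K = "\<lambda>\<tau>. L \<tau> + L0 ** predictor_gain \<tau>"
    have "v \<in> U_ad x0 \<and> (\<lambda>t. second_moment (state x0 v t)) \<longlonglongrightarrow> 0"
      if v: "closed_loop (state_feedback L0 ?K x0) \<phi> v" for x0 \<phi> v
    proof -
      obtain u where u: "closed_loop (predictor_feedback L0 L x0) \<phi> u"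
        using predictor_feedback_closed_loop_exists by blast
      with stab show ?thesis using corr[OF u v] by simp
    qed
    then show "\<exists>K0 K. \<forall>x0 \<phi> u. closed_loop (state_feedback K0 K x0) \<phi> u \<longrightarrow>
        u \<in> U_ad x0 \<and> (\<lambda>t. second_moment (state x0 u t)) \<longlonglongrightarrow> 0"
      by blast
  qed
qed

end
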